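(* Let $p>1$ and $q\in[1,p]$. For any non-increasing $g:(0,1]\to[0,\infty)$ with $\int_0^1g(u)\,du=f$ (finite) and any $\beta>0$, $$\int_0^1\left(\frac1t\int_0^tg(u)\,du\right)^p dt\ \le\ -\frac{q(\beta+1)}{(p-1)q\beta+(p-q)}\,f^p+\frac{p(\beta+1)^q}{(p-1)q\beta+(p-q)}\int_0^1\left(\frac1t\int_0^tg(u)\,du\right)^{p-q}g^q(t)\,dt .$$ Moreover, this inequality is sharp for any $\beta$ with $0<\beta\le\frac1{p-1}$: for every $f>0$ and every $c>\frac{q(\beta+1)}{(p-1)q\beta+(p-q)}$ there exists a non-increasing $g:(0,1]\to[0,\infty)$ with $\int_0^1g(u)\,du=f$ for which the inequality $$\int_0^1\left(\frac1t\int_0^tg(u)\,du\right)^p dt\le -c\,f^p+\frac{p(\beta+1)^q}{(p-1)q\beta+(p-q)}\int_0^1\left(\frac1t\int_0^tg(u)\,du\right)^{p-q}g^q(t)\,dt$$ fails.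
   Context: Integrals of nonnegative functions are taken in $[0,\infty]$. *)

theory Defs
  imports "HOL-Analysis.Analysis"
begin

definition avg :: "(real \<Rightarrow> real) \<Rightarrow> real \<Rightarrow> real" where
  "avg g t = (1 / t) * (LINT u:{0<..t}|lborel. g u)"

text \<open>
  Only the values of \<open>g\<close> on \<open>(0,1]\<close> matter. The integral of \<open>g\<close> is taken in \<open>[0,\<infinity>]\<close>; its
  finiteness makes \<open>g\<close> integrable on every \<open>(0,t]\<close>, so the Bochner integral in \<open>avg g t\<close>
  is the true one. The bound \<open>0 \<le> f\<close> is needed because \<open>ennreal\<close> truncates negative reals to 0.
\<close>
definition noninc_with_integral :: "real \<Rightarrow> (real \<Rightarrow> real) \<Rightarrow> bool" where
  "noninc_with_integral f g \<longleftrightarrow>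
     (\<forall>u\<in>{0<..1}. 0 \<le> g u) \<and>
     antimono_on {0<..1} g \<and>
     0 \<le> f \<and> (\<integral>\<^sup>+u\<in>{0<..1}. ennreal (g u) \<partial>lborel) = ennreal f"

definition int_avg_pow :: "real \<Rightarrow> (real \<Rightarrow> real) \<Rightarrow> ennreal" where
  "int_avg_pow p g = (\<integral>\<^sup>+t\<in>{0<..1}. ennreal (avg g t powr p) \<partial>lborel)"

text \<open>
  In Isabelle \<open>0 powr 0 = 0\<close>. This is harmless for \<open>p = q\<close>: if \<open>avg g t = 0\<close> for a
  non-increasing \<open>g \<ge> 0\<close> and \<open>0 < t \<le> 1\<close>, then \<open>g t = 0\<close>, and the second factor vanishes.
\<close>
definition int_avg_mixed :: "real \<Rightarrow> real \<Rightarrow> (real \<Rightarrow> real) \<Rightarrow> ennreal" where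
  "int_avg_mixed p q g =
     (\<integral>\<^sup>+t\<in>{0<..1}. ennreal (avg g t powr (p - q) * g t powr q) \<partial>lborel)"

end

(*
  Let A(t) be the average of g over (0,t]. Convexity of x^q at x = 1/(\<beta>+1) gives the pointwise bound
    (1 - q) A^p + q (\<beta>+1) A^(p-1) g \<le> (\<beta>+1)^q A^(p-q) g^q,
  while (t A^p)' = (1 - p) A^p + p A^(p-1) g turns the integral of A^(p-1) g into that of A^p
  plus a multiple of f^p. For bounded g the boundary term at 0 vanishes; the general case follows
  by truncating g at height n and monotone convergence, since truncation only decreases the
  integral on the right-hand side.

  The tangency is an equality for g = A/(\<beta>+1), that is A = f t^(-a) with a = \<beta>/(\<beta>+1), but for
  \<beta> = 1/(p-1) both integrals then diverge. Exponents b slightly below a work for all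
  \<beta> \<le> 1/(p-1): the margin by which the inequality with constant c fails, multiplied by 1 - bp,
  is nonnegative and strictly decreasing in b at b = a.
*)
theory Submission
  imports Defs
begin

section \<open>A fundamental theorem of calculus with a countable exceptional set\<close>

lemma has_integral_Ioc_iff_Icc:
  fixes f :: "real \<Rightarrow> real"
  shows "(f has_integral y) {a<..b} \<longleftrightarrow> (f has_integral y) {a..b}"
  by (rule has_integral_spike_set_eq) (auto intro: negligible_subset[of "{a}"])

text \<open>A small linear tilt makes every available derivative strictly positive. The exceptional
  points can be dodged because they take only countably many values, while a drop of the tilted
  function would leave a whole interval of values to choose from.\<close>

lemma nonneg_deriv_countable_imp_le:
  fixes f :: "real \<Rightarrow> real"
  assumes "a \<le> b" "countable S" and cont: "continuous_on {a..b} f"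
    and deriv: "\<And>x. x \<in> {a<..<b} - S \<Longrightarrow> \<exists>D\<ge>0. (f has_real_derivative D) (at x)"
  shows "f a \<le> f b"
proof (rule ccontr)
  assume "\<not> f a \<le> f b"
  then have "a < b" and lt: "f b < f a" using \<open>a \<le> b\<close> by (cases "a = b"; simp)+
  \<comment> \<open>With this slope the tilt makes up only half of the supposed drop from f a to f
    b, so the tilted function \<open>g\<close> still satisfies \<open>g b < g a\<close>.\<close>
  define e where "e = (f a - f b) / 2 / (b - a)"
  have "e > 0" using lt \<open>a < b\<close> by (simp add: e_def)
  define g where "g x = f x + e * (x - a)" for x
  have "b - a \<noteq> 0" using \<open>a < b\<close> by simp
  from iffD1[OF nonzero_eq_divide_eq[OF this] e_def]
  have "e * (b - a) = (f a - f b) / 2" .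
  then have gab: "g b < g a" using lt by (simp add: g_def field_simps)
  have contg: "continuous_on {a..b} g"
    unfolding g_def by (intro continuous_intros cont)
  (* A value y missed by g on S: at the last point c with g c \<ge> y, the derivative of g
     exists and is positive. *)
  have "uncountable ({g b<..<g a} - g ` S)"
    using gab \<open>countable S\<close> by (simp add: uncountable_minus_countable uncountable_open_interval)
  then obtain y where y: "g b < y" "y < g a" "y \<notin> g ` S"
    by (metis Diff_iff countable_empty ex_in_conv greaterThanLessThan_iff)
  define T where "T = {x \<in> {a..b}. y \<le> g x}"
  have "closed T"
    unfolding T_def
    by (rule continuous_closed_preimage[of _ g "{y..}", simplified vimage_def Int_def, simplified])
       (use contg in auto)
  have T: "a \<in> T" "bdd_above T" using y \<open>a < b\<close> by (auto simp: T_def intro: bdd_aboveI[of _ b])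
  define c where "c = Sup T"
  have "c \<in> T" using closed_contains_Sup[of T] T \<open>closed T\<close> by (auto simp: c_def)
  then have "c < b" using y by (cases "c = b") (auto simp: T_def)
  have above: "g x < y" if "c < x" "x \<le> b" for x
  proof (rule ccontr)
    assume "\<not> g x < y"
    then have "x \<in> T" using that \<open>c \<in> T\<close> by (auto simp: T_def)
    then show False using cSup_upper[OF _ T(2), of x] that by (simp add: c_def)
  qed
  \<comment> \<open>If \<open>g c\<close> exceeded \<open>y\<close>, the intermediate value theorem
    would give a point to the right of \<open>c\<close> with value \<open>y\<close>, against
    \<open>above\<close>. Equality then yields that \<open>c\<close> is not in \<open>S\<close> (no
    point of \<open>S\<close> has value \<open>y\<close>) and that \<open>c\<close> differs from
    \<open>a\<close>.\<close>
  have "g c = y"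
  proof (rule ccontr)
    assume "g c \<noteq> y"
    then have "y < g c" using \<open>c \<in> T\<close> by (simp add: T_def)
    moreover have "continuous_on {c..b} g"
      using contg \<open>c \<in> T\<close> by (auto simp: T_def intro: continuous_on_subset)
    ultimately obtain x where "c \<le> x" "x \<le> b" "g x = y"
      using IVT2'[of g b y c] y \<open>c < b\<close> by auto
    then show False using above[of x] \<open>g c \<noteq> y\<close> by (cases "x = c") auto
  qed
  then have "c \<notin> S" "c \<noteq> a" using y by auto
  then have "c \<in> {a<..<b} - S" using \<open>c \<in> T\<close> \<open>c < b\<close> by (auto simp: T_def)
  then obtain D where "D \<ge> 0" "(f has_real_derivative D) (at c)" using deriv by blast
  then have "(g has_real_derivative D + e) (at c)"
    unfolding g_def by (auto intro!: derivative_eq_intros)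
  from DERIV_pos_inc_right[OF this] \<open>D \<ge> 0\<close> \<open>e > 0\<close>
  obtain d where d: "d > 0" "\<And>h. 0 < h \<Longrightarrow> h < d \<Longrightarrow> g c < g (c + h)" by auto
  define h where "h = min (d / 2) (b - c)"
  have "0 < h" "h < d" "c + h \<le> b" using d \<open>c < b\<close> by (auto simp: h_def)
  then show False using d(2)[of h] above[of "c + h"] \<open>g c = y\<close> by auto
qed

text \<open>F minus the indefinite integral of f is continuous with derivative 0 off
  \<open>S\<close>, so the preceding monotonicity result applies to it and to its negative. It will
  be applied with \<open>S\<close> the set of discontinuities of a monotone function.\<close>

lemma fundamental_theorem_of_calculus_countable:
  fixes f F :: "real \<Rightarrow> real"
  assumes "a \<le> b" "countable S" and int: "f integrable_on {a..b}"
    and cont: "continuous_on {a..b} F"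
    and deriv: "\<And>x. x \<in> {a<..<b} - S \<Longrightarrow> isCont f x"
      "\<And>x. x \<in> {a<..<b} - S \<Longrightarrow> (F has_real_derivative f x) (at x)"
  shows "integral {a..b} f = F b - F a"
proof -
  let ?I = "\<lambda>x. integral {a..x} f"
  have I: "(?I has_real_derivative f x) (at x)" if x: "x \<in> {a<..<b} - S" for x
  proof -
    have "(?I has_vector_derivative f x) (at x within {a..b})"
      using integral_has_vector_derivative_continuous_at[OF int, of x "{}"] x deriv(1)[OF x]
      by (auto simp: continuous_at_imp_continuous_at_within)
    then have "(?I has_vector_derivative f x) (at x)"
      using x by (simp add: at_within_Icc_at)
    then show ?thesis by (simp add: has_real_derivative_iff_has_vector_derivative)
  qed
  have cI: "continuous_on {a..b} ?I" by (rule indefinite_integral_continuous_1[OF int])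
  have "F a - ?I a \<le> F b - ?I b"
    by (rule nonneg_deriv_countable_imp_le[OF \<open>a \<le> b\<close> \<open>countable S\<close>])
       (auto intro!: continuous_intros cont cI derivative_eq_intros I deriv(2) exI[of _ 0])
  moreover have "?I a - F a \<le> ?I b - F b"
    by (rule nonneg_deriv_countable_imp_le[OF \<open>a \<le> b\<close> \<open>countable S\<close>])
       (auto intro!: continuous_intros cont cI derivative_eq_intros I deriv(2) exI[of _ 0])
  ultimately show ?thesis by simp
qed

section \<open>Regularity of non-increasing functions\<close>

lemma antimono_on_set_borel_measurable:
  fixes g :: "real \<Rightarrow> real"
  assumes "antimono_on A g" "A \<in> sets borel"
  shows "set_borel_measurable borel A g"
proof -
  have "mono_on A (\<lambda>x. - g x)"
    using assms(1) by (auto simp: monotone_on_def)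
  from borel_measurable_uminus[OF borel_measurable_mono_on_fnc[OF this]]
  have "g \<in> borel_measurable (restrict_space borel A)" by simp
  then show ?thesis
    using assms(2) by (simp add: borel_measurable_restrict_space_iff set_borel_measurable_def)
qed

lemma antimono_on_countable_discont:
  fixes g :: "real \<Rightarrow> real"
  assumes "antimono_on A g" "open A"
  shows "countable {x \<in> A. \<not> isCont g x}"
proof -
  have "mono_on A (\<lambda>x. - g x)"
    using assms(1) by (auto simp: monotone_on_def)
  from mono_on_ctble_discont_open[OF assms(2) this]
  have "countable {x \<in> A. \<not> isCont (\<lambda>x. - g x) x}" .
  moreover have "{x \<in> A. \<not> isCont g x} \<subseteq> {x \<in> A. \<not> isCont (\<lambda>x. - g x) x}"
    using continuous_minus[of _ "\<lambda>x. - g x"] by auto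
  ultimately show ?thesis by (rule countable_subset[rotated])
qed

section \<open>The pointwise tangent-line inequality\<close>

text \<open>After division by A^p and the substitution y = (b+1)x/A this is Bernoulli's inequality 1
  + q(y-1) \<le> y^q, with equality at y = 1, that is x = A/(b+1).\<close>

lemma powr_above_tangent:
  fixes A x b p q :: real
  assumes "1 \<le> q" "q \<le> p" "0 < b" "0 \<le> A" "0 \<le> x"
  shows "(1 - q) * A powr p + q * (b + 1) * (A powr (p - 1) * x)
         \<le> (b + 1) powr q * (A powr (p - q) * x powr q)"
proof (cases "A = 0 \<or> x = 0")
  \<comment> \<open>No division by A is possible here, but the mixed terms on both sides vanish
    (also by \<open>0 powr 0 = 0\<close> when A = 0 and p = q), and what remains on the left is at
    most 0 because q \<ge> 1.\<close>
  case True
  have "(1 - q) * A powr p \<le> 0" using assms by (intro mult_nonpos_nonneg) auto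
  then show ?thesis using True by auto
next
  case False
  then have "A > 0" "x > 0" using assms by auto
  define y where "y = (b + 1) * x / A"
  have "y > 0" using \<open>A > 0\<close> \<open>x > 0\<close> assms by (simp add: y_def)
  have bern: "1 + q * (y - 1) \<le> y powr q"
  proof -
    have "((\<lambda>x. x powr q) has_real_derivative q * 1 powr (q - 1)) (at 1)"
      by (rule has_real_derivative_powr) simp
    then have "((\<lambda>x. x powr q) has_real_derivative q * 1 powr (q - 1)) (at 1 within {0<..})"
      by (rule has_field_derivative_at_within)
    then have "y powr q - 1 powr q \<ge> q * 1 powr (q - 1) * (y - 1)"
      by (rule convex_on_imp_above_tangent[OF powr_convex[OF \<open>1 \<le> q\<close>], rotated 3])
         (use \<open>y > 0\<close> in \<open>simp_all add: interior_open\<close>)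
    then show ?thesis by simp
  qed
  have "(1 - q) * A powr p + q * (b + 1) * (A powr (p - 1) * x) = A powr p * (1 + q * (y - 1))"
  proof -
    have "A powr (p - 1) * x = A powr p * (x / A)" using \<open>A > 0\<close> by (simp add: powr_diff)
    then have "q * (b + 1) * (A powr (p - 1) * x) = A powr p * (q * y)" by (simp add: y_def)
    then show ?thesis by (simp add: algebra_simps)
  qed
  also have "\<dots> \<le> A powr p * y powr q" using bern by (intro mult_left_mono) auto
  also have "\<dots> = (b + 1) powr q * (A powr (p - q) * x powr q)"
  proof -
    have "y powr q = (b + 1) powr q * x powr q / A powr q"
      using \<open>A > 0\<close> \<open>x > 0\<close> assms by (simp add: y_def powr_divide powr_mult)
    moreover have "A powr (p - q) = A powr p / A powr q" by (rule powr_diff)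
    ultimately show ?thesis by simp
  qed
  finally show ?thesis .
qed

section \<open>The averaging operator: integrals, monotonicity, continuity, measurability\<close>

text \<open>Passes from the Lebesgue integral over a half-open interval to the gauge integral over
  the closed one, for which the results on indefinite integrals are used below; the added endpoint
  is a null set.\<close>

lemma has_integral_avg:
  assumes "set_integrable lborel {0<..1} g" "0 < t" "t \<le> 1"
  shows "(g has_integral t * avg g t) {0..t}"
proof -
  have "set_integrable lborel {0<..t} g"
    by (rule set_integrable_subset[OF assms(1)]) (use assms in auto)
  from set_borel_integral_eq_integral[OF this]
  have "(g has_integral t * avg g t) {0<..t}"
    using \<open>0 < t\<close> by (simp add: avg_def has_integral_integral)
  then show ?thesis
    by (simp only: has_integral_Ioc_iff_Icc)
qed

text \<open>The case t = 0 is included because division by 0 gives 0 on both sides.\<close>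

lemma avg_eq_integral:
  assumes "set_integrable lborel {0<..1} g" "0 \<le> t" "t \<le> 1"
  shows "avg g t = integral {0..t} g / t"
proof (cases "t = 0")
  case False
  then have "t > 0" using assms by simp
  then show ?thesis
    using integral_unique[OF has_integral_avg[OF assms(1) \<open>t > 0\<close> assms(3)]] by simp
qed (simp add: avg_def)

lemma avg_mono:
  assumes "set_integrable lborel {0<..1} g" "set_integrable lborel {0<..1} h" "0 < t" "t \<le> 1"
    and "\<And>u. 0 < u \<Longrightarrow> u \<le> t \<Longrightarrow> g u \<le> h u"
  shows "avg g t \<le> avg h t"
proof -
  have "set_lebesgue_integral lborel {0<..t} g \<le> set_lebesgue_integral lborel {0<..t} h"
  proof (rule set_integral_mono)
    show "set_integrable lborel {0<..t} g" "set_integrable lborel {0<..t} h"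
      using \<open>t \<le> 1\<close>
      by (auto intro: set_integrable_subset[OF assms(1)] set_integrable_subset[OF assms(2)])
  qed (use assms(5) in simp)
  then show ?thesis using \<open>0 < t\<close> by (simp add: avg_def divide_right_mono)
qed

lemma avg_const: "0 < t \<Longrightarrow> avg (\<lambda>u. c) t = c"
  by (simp add: avg_def set_lebesgue_integral_def measure_def)

lemma set_integrable_const_Ioc: "set_integrable lborel {0<..1::real} (\<lambda>u. c::real)"
  by (simp add: set_integrable_def)

lemma set_integrable_bounded:
  fixes h :: "real \<Rightarrow> real"
  assumes "set_borel_measurable borel {0<..1} h" "\<And>t. 0 < t \<Longrightarrow> t \<le> 1 \<Longrightarrow> \<bar>h t\<bar> \<le> B"
  shows "set_integrable lborel {0<..1} h"
proof (rule set_integrable_bound[OF set_integrable_const_Ioc[of B]])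
  show "AE x in lborel. x \<in> {0<..1} \<longrightarrow> norm (h x) \<le> norm B"
  proof (rule AE_I2, rule impI)
    show "norm (h x) \<le> norm B" if "x \<in> {0<..1}" for x using assms(2)[of x] that by simp
  qed
qed (use assms(1) in \<open>simp add: set_borel_measurable_def\<close>)

lemma continuous_on_avg:
  assumes "set_integrable lborel {0<..1} g"
  shows "continuous_on {0<..1} (avg g)"
proof -
  have "g integrable_on {0..1}" using has_integral_avg[OF assms, of 1] by auto
  then have "continuous_on {0<..1} (\<lambda>x. integral {0..x} g)"
    by (rule continuous_on_subset[OF indefinite_integral_continuous_1]) auto
  then have "continuous_on {0<..1} (\<lambda>x. integral {0..x} g / x)"
    by (rule continuous_on_divide[OF _ continuous_on_id]) auto
  then show ?thesis
    by (rule continuous_on_eq) (simp add: avg_eq_integral[OF assms])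
qed

lemma set_borel_measurable_avg:
  assumes "set_integrable lborel {0<..1} g"
  shows "set_borel_measurable borel {0<..1} (avg g)"
  using borel_measurable_continuous_on_indicator[OF _ continuous_on_avg[OF assms]]
  by (simp add: set_borel_measurable_def)

lemma set_borel_measurable_powr_mult:
  fixes g h :: "real \<Rightarrow> real"
  assumes "set_borel_measurable borel S g" "set_borel_measurable borel S h" "S \<in> sets borel"
  shows "set_borel_measurable borel S (\<lambda>t. g t powr a * h t powr b)"
proof -
  have [measurable]: "(\<lambda>x. indicator S x * g x) \<in> borel_measurable borel"
      "(\<lambda>x. indicator S x * h x) \<in> borel_measurable borel" "S \<in> sets borel"
    using assms by (simp_all add: set_borel_measurable_def)
  \<comment> \<open>The inner indicators replace g and h by globally measurable functions. They
    change nothing: on \<open>S\<close> they are 1, and off \<open>S\<close> the outer indicator is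
    0.\<close>
  have "(\<lambda>x. indicator S x * ((indicator S x * g x) powr a * (indicator S x * h x) powr b))
      \<in> borel_measurable borel"
    by measurable
  also have "(\<lambda>x. indicator S x * ((indicator S x * g x) powr a * (indicator S x * h x) powr b))
    = (\<lambda>x. indicator S x *\<^sub>R (g x powr a * h x powr b))"
    by (auto simp: indicator_def)
  finally show ?thesis by (simp add: set_borel_measurable_def)
qed

lemma avg_bounds:
  fixes g :: "real \<Rightarrow> real"
  assumes gi: "set_integrable lborel {0<..1} g" and "0 < t" "t \<le> 1"
  shows "(\<And>u. 0 < u \<Longrightarrow> u \<le> t \<Longrightarrow> c \<le> g u) \<Longrightarrow> c \<le> avg g t"
    and "(\<And>u. 0 < u \<Longrightarrow> u \<le> t \<Longrightarrow> g u \<le> c) \<Longrightarrow> avg g t \<le> c"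
  using avg_mono[OF set_integrable_const_Ioc gi assms(2,3), of c]
    avg_mono[OF gi set_integrable_const_Ioc assms(2,3), of c] avg_const[OF assms(2), of c]
  by simp_all

section \<open>The inequality for bounded non-increasing functions\<close>

text \<open>Wherever g is continuous, \<open>h\<close> is the derivative of t A(t)^p, with A the
  average of g; the remaining points are countable. The integral is therefore the boundary value at
  1 minus that at 0, and boundedness of g makes the latter vanish. Positivity of
  \<open>avg g 1\<close> forces A > 0 on (0,1], so that the powers of A can be
  differentiated.\<close>

lemma bounded_hardy_identity:
  fixes g :: "real \<Rightarrow> real"
  assumes "1 < p" and anti: "antimono_on {0<..1} g"
    and bd: "\<And>u. 0 < u \<Longrightarrow> u \<le> 1 \<Longrightarrow> 0 \<le> g u \<and> g u \<le> M"
    and pos: "0 < avg g 1"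
    and h_def: "h = (\<lambda>t. (1 - p) * avg g t powr p + p * (avg g t powr (p - 1) * g t))"
    and int: "h integrable_on {0..1}"
  shows "integral {0..1} h = avg g 1 powr p"
proof -
  have gi: "set_integrable lborel {0<..1} g"
  proof (rule set_integrable_bounded[of _ M])
    show "\<bar>g t\<bar> \<le> M" if "0 < t" "t \<le> 1" for t using bd[OF that] by simp
  qed (rule antimono_on_set_borel_measurable[OF anti], simp)
  have A0: "0 \<le> avg g t" and AM: "avg g t \<le> M" and gA: "g t \<le> avg g t" if t: "0 < t" "t \<le> 1" for t
  proof -
    show "0 \<le> avg g t" "avg g t \<le> M"
      by (rule avg_bounds[OF gi t]; use bd t in simp)+
    show "g t \<le> avg g t"
      by (rule avg_bounds[OF gi t]) (use monotone_onD[OF anti] t in auto)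
  qed
  let ?F = "\<lambda>t. integral {0..t} g"
  have g1: "g integrable_on {0..1}" using has_integral_avg[OF gi, of 1] by auto
  have A: "avg g t = ?F t / t" if "0 \<le> t" "t \<le> 1" for t
    using avg_eq_integral[OF gi that] .
  \<comment> \<open>If A(t) = 0, then 0 \<le> g(t) \<le> A(t) gives g(t) = 0, and monotonicity gives
    g \<le> 0 on [t,1]. The integral over (0,1] would then be at most t A(t) = 0, contradicting
    \<open>pos\<close>.\<close>
  have Apos: "0 < avg g t" if t: "0 < t" "t \<le> 1" for t
  proof (rule ccontr)
    assume "\<not> 0 < avg g t"
    then have "avg g t = 0" "g t = 0" using A0[OF t] gA[OF t] bd[of t] t by auto
    have "integral {t..1} g \<le> integral {t..1} (\<lambda>x. 0)"
    proof (rule integral_le)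
      show "g integrable_on {t..1}" using t by (intro integrable_subinterval_real[OF g1]) auto
      show "g x \<le> 0" if "x \<in> {t..1}" for x
        using monotone_onD[OF anti, of t x] that t \<open>g t = 0\<close> by auto
    qed auto
    moreover have "?F t + integral {t..1} g = ?F 1"
      by (rule Henstock_Kurzweil_Integration.integral_combine[OF _ _ g1]) (use t in auto)
    ultimately show False
      using pos A[of 1] A[of t] \<open>avg g t = 0\<close> t by simp
  qed
  define H where "H t = t * avg g t powr p" for t
  have "continuous_on {0..1} H"
    unfolding continuous_on_def
  proof
    fix x :: real assume x: "x \<in> {0..1}"
    show "(H \<longlongrightarrow> H x) (at x within {0..1})"
    proof (cases "x = 0")
      case True
      have ev: "\<forall>\<^sub>F t in at 0 within {0..1}. 0 < t \<and> t \<le> (1::real)"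
        by (auto simp: eventually_at_filter)
      \<comment> \<open>The only place where boundedness gives the boundary term: 0 \<le> H(t) \<le>
        t M^p.\<close>
      have "(H \<longlongrightarrow> 0) (at 0 within {0..1})"
      proof (rule tendsto_sandwich)
        show "\<forall>\<^sub>F t in at 0 within {0..1}. 0 \<le> H t"
          using ev by eventually_elim (simp add: H_def)
        show "\<forall>\<^sub>F t in at 0 within {0..1}. H t \<le> t * M powr p"
          using ev
        proof eventually_elim
          case (elim t)
          then show ?case
            using A0[of t] AM[of t] \<open>1 < p\<close> by (auto simp: H_def intro!: mult_left_mono powr_mono2)
        qed
        show "((\<lambda>t::real. t * M powr p) \<longlongrightarrow> 0) (at 0 within {0..1})"
          by (intro tendsto_mult_left_zero tendsto_ident_at)
      qed (rule tendsto_const)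
      then show ?thesis using True by (simp add: H_def)
    next
      case False
      have "continuous_on {0<..1} H"
        unfolding H_def using A0 \<open>1 < p\<close>
        by (intro continuous_intros continuous_on_powr' continuous_on_avg gi) auto
      then have "(H \<longlongrightarrow> H x) (at x within {0<..1})"
        using x False by (auto simp: continuous_on_def)
      also have "at x within {0<..1} = at x within {0..1}"
        by (rule at_within_nhd[of x "{0<..}"]) (use x False in auto)
      finally show ?thesis .
    qed
  qed
  have deriv: "isCont h x \<and> (H has_real_derivative h x) (at x)"
    if x: "x \<in> {0<..<1}" and cont: "isCont g x" for x
  proof
    have ev: "\<forall>\<^sub>F t in nhds x. avg g t = ?F t / t"
      using eventually_nhds_in_open[of "{0<..<1}" x] x by (auto elim!: eventually_mono simp: A)
    have "(?F has_vector_derivative g x) (at x within {0..1})"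
      using integral_has_vector_derivative_continuous_at[OF g1, of x "{}"] x cont
      by (auto simp: continuous_at_imp_continuous_at_within)
    then have F': "(?F has_real_derivative g x) (at x)"
      using x by (simp add: at_within_Icc_at has_real_derivative_iff_has_vector_derivative)
    have "0 < x" and "x \<le> 1" using x by auto
    \<comment> \<open>Quotient rule, with derivative g(x) of the numerator and numerator value x
      A(x).\<close>
    have d: "((\<lambda>t. ?F t / t) has_real_derivative (g x - avg g x) / x) (at x)"
      using \<open>0 < x\<close> \<open>x \<le> 1\<close>
      by (auto intro!: derivative_eq_intros F' simp: A field_simps)
    then have d: "(avg g has_real_derivative (g x - avg g x) / x) (at x)"
      using DERIV_cong_ev[OF refl ev refl] by simp
    from DERIV_fun_powr[OF d Apos[OF \<open>0 < x\<close> \<open>x \<le> 1\<close>], of p]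
    have "(H has_real_derivative
        1 * avg g x powr p + (p * avg g x powr (p - 1) * ((g x - avg g x) / x)) * x) (at x)"
      unfolding H_def by (intro DERIV_mult DERIV_ident) simp
    also have "1 * avg g x powr p + (p * avg g x powr (p - 1) * ((g x - avg g x) / x)) * x = h x"
      using \<open>0 < x\<close> Apos[OF \<open>0 < x\<close> \<open>x \<le> 1\<close>] by (simp add: h_def powr_diff field_simps)
    finally show "(H has_real_derivative h x) (at x)" .
    show "isCont h x"
      unfolding h_def
      using Apos[OF \<open>0 < x\<close> \<open>x \<le> 1\<close>]
      by (intro continuous_intros cont DERIV_isCont[OF d]) auto
  qed
  have "integral {0..1} h = H 1 - H 0"
  proof (rule fundamental_theorem_of_calculus_countable[where S = "{x \<in> {0<..<1}. \<not> isCont g x}"])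
    show "countable {x \<in> {0<..<1}. \<not> isCont g x}"
      by (rule antimono_on_countable_discont) (auto intro: monotone_on_subset[OF anti])
  qed (use deriv int \<open>continuous_on {0..1} H\<close> in simp_all)
  then show ?thesis by (simp add: H_def)
qed

lemma set_nn_integral_eq_integral:
  fixes h :: "real \<Rightarrow> real"
  assumes "set_integrable lborel {0<..1} h" "\<And>t. t \<in> {0<..1} \<Longrightarrow> 0 \<le> h t"
  shows "(\<integral>\<^sup>+t\<in>{0<..1}. ennreal (h t) \<partial>lborel) = ennreal (integral {0..1} h)"
    and "h integrable_on {0..1}"
proof -
  have int: "(h has_integral integral {0<..1} h) {0<..1}"
    using set_borel_integral_eq_integral(1)[OF assms(1)] by (rule integrable_integral)
  then have int': "(h has_integral integral {0<..1} h) {0..1}"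
    by (simp only: has_integral_Ioc_iff_Icc)
  show "(\<integral>\<^sup>+t\<in>{0<..1}. ennreal (h t) \<partial>lborel) = ennreal (integral {0..1} h)"
    using nn_integral_has_integral_lebesgue'[OF assms(2) int] integral_unique[OF int'] by simp
  show "h integrable_on {0..1}" using int' by blast
qed

text \<open>The denominator is cleared and the boundary term is moved to the left, so that all terms
  are nonnegative and the inequality makes sense in [0,\<infinity>] without subtraction. Boundedness
  makes every integral finite, so the proof itself runs in the reals.\<close>

lemma avg_inequality_bounded:
  fixes g :: "real \<Rightarrow> real"
  assumes p: "1 < p" and q: "1 \<le> q" "q \<le> p" and \<beta>: "0 < \<beta>" and anti: "antimono_on {0<..1} g"
    and bd: "\<And>u. 0 < u \<Longrightarrow> u \<le> 1 \<Longrightarrow> 0 \<le> g u \<and> g u \<le> M"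
  shows "ennreal ((p - 1) * q * \<beta> + (p - q)) * int_avg_pow p g + ennreal (q * (\<beta> + 1) * avg g 1 powr p)
    \<le> ennreal (p * (\<beta> + 1) powr q) * int_avg_mixed p q g"
proof -
  define D where "D = (p - 1) * q * \<beta> + (p - q)"
  have "0 \<le> D" using p q \<beta> by (simp add: D_def)
  have gm: "set_borel_measurable borel {0<..1} g"
    by (rule antimono_on_set_borel_measurable[OF anti]) simp
  have gi: "set_integrable lborel {0<..1} g"
    by (rule set_integrable_bounded[OF gm, of M]) (use bd in force)
  have A: "0 \<le> avg g t" "avg g t \<le> M" if t: "0 < t" "t \<le> 1" for t
    by (rule avg_bounds[OF gi t]; use bd t in simp)+
  have M0: "0 \<le> M" using A[of 1] by simp
  have int: "set_integrable lborel {0<..1} (\<lambda>t. avg g t powr a * g t powr b)" if "0 \<le> a" "0 \<le> b" for a b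
  proof (rule set_integrable_bounded)
    show "set_borel_measurable borel {0<..1} (\<lambda>t. avg g t powr a * g t powr b)"
      by (rule set_borel_measurable_powr_mult[OF set_borel_measurable_avg[OF gi] gm]) simp
    show "\<bar>avg g t powr a * g t powr b\<bar> \<le> M powr a * M powr b" if "0 < t" "t \<le> 1" for t
      using A[OF that] bd[OF that] \<open>0 \<le> a\<close> \<open>0 \<le> b\<close>
      by (auto simp: abs_mult intro!: mult_mono powr_mono2)
  qed
  \<comment> \<open>This is not the case b = 0 of \<open>int\<close>: as
    \<open>0 powr 0 = 0\<close>, the factor \<open>g t powr 0\<close> would vanish wherever g
    does.\<close>
  have int0: "set_integrable lborel {0<..1} (\<lambda>t. avg g t powr p)"
  proof (rule set_integrable_bounded)
    have "set_borel_measurable borel {0<..1} (\<lambda>t. avg g t powr p * 1 powr 1)"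
      by (rule set_borel_measurable_powr_mult[OF set_borel_measurable_avg[OF gi]])
         (auto simp: set_borel_measurable_def)
    then show "set_borel_measurable borel {0<..1} (\<lambda>t. avg g t powr p)" by simp
    show "\<bar>avg g t powr p\<bar> \<le> M powr p" if "0 < t" "t \<le> 1" for t
      using A[OF that] p by (auto intro!: powr_mono2)
  qed
  let ?P = "\<lambda>t. avg g t powr p" and ?R = "\<lambda>t. avg g t powr (p - 1) * g t"
    and ?Q = "\<lambda>t. avg g t powr (p - q) * g t powr q"
  have "set_integrable lborel {0<..1} ?R"
    by (rule set_integrable_cong[THEN iffD1, OF refl refl _ int[of "p - 1" 1]]) (use bd p in auto)
  note R = set_nn_integral_eq_integral(2)[OF this]
  note P = set_nn_integral_eq_integral[OF int0]
  have Q: "int_avg_mixed p q g = ennreal (integral {0..1} ?Q)" "?Q integrable_on {0..1}"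
    using set_nn_integral_eq_integral[OF int[of "p - q" q]] q by (simp_all add: int_avg_mixed_def)
  define h where "h = (\<lambda>t. (1 - p) * ?P t + p * ?R t)"
  have h: "h integrable_on {0..1}"
    unfolding h_def using P(2) R bd p
    by (intro integrable_add integrable_on_mult_right) auto
  have main: "avg g 1 powr p \<le> integral {0..1} h"
  proof (cases "avg g 1 = 0")
    case False
    then have "0 < avg g 1" using A[of 1] by simp
    from bounded_hardy_identity[OF p anti bd this h_def h] show ?thesis by simp
  next
    \<comment> \<open>Since g \<ge> 0, t A(t) is at most A(1) = 0, so A vanishes on (0,1]; at t = 0
      it is 0 by convention. Hence \<open>h\<close> is identically 0 and both sides of the claim are
      0.\<close>
    case True
    have "avg g t = 0" if t: "0 < t" "t \<le> 1" for t
    proof -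
      have "t * avg g t \<le> 1 * avg g 1"
      proof (rule has_integral_subset_le)
        show "(g has_integral t * avg g t) {0<..t}" "(g has_integral 1 * avg g 1) {0<..1}"
          using has_integral_avg[OF gi t] has_integral_avg[OF gi, of 1]
          by (simp_all add: has_integral_Ioc_iff_Icc)
      qed (use t bd in auto)
      then show ?thesis using A[OF t] t True by (simp add: mult_le_0_iff)
    qed
    then have h0: "h t = 0" if "t \<in> {0..1}" for t
      using that by (cases "t = 0") (auto simp: h_def avg_def)
    have "integral {0..1} h = integral {0..1::real} (\<lambda>t. 0)"
      by (rule Henstock_Kurzweil_Integration.integral_cong) (rule h0)
    then show ?thesis using True by simp
  qed
  have "D * integral {0..1} ?P + q * (\<beta> + 1) * integral {0..1} h
      \<le> p * (\<beta> + 1) powr q * integral {0..1} ?Q"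
  proof (rule has_integral_le)
    show "((\<lambda>t. D * ?P t + q * (\<beta> + 1) * h t) has_integral
        D * integral {0..1} ?P + q * (\<beta> + 1) * integral {0..1} h) {0..1}"
      using P(2) h by (intro has_integral_add has_integral_mult_right integrable_integral) auto
    show "((\<lambda>t. p * (\<beta> + 1) powr q * ?Q t) has_integral
        p * (\<beta> + 1) powr q * integral {0..1} ?Q) {0..1}"
      using Q(2) by (intro has_integral_mult_right integrable_integral)
    show "D * ?P t + q * (\<beta> + 1) * h t \<le> p * (\<beta> + 1) powr q * ?Q t" if "t \<in> {0..1}" for t
    proof (cases "t = 0")
      case False
      then have t: "0 < t" "t \<le> 1" using that by auto
      \<comment> \<open>The value of \<open>D\<close> is what makes this work: the coefficient of
        A^p is D + q(\<beta>+1)(1-p) = p(1-q), so p times the left-hand side of the tangent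
        inequality appears.\<close>
      have "D * ?P t + q * (\<beta> + 1) * h t = p * ((1 - q) * ?P t + q * (\<beta> + 1) * ?R t)"
        by (simp add: D_def h_def algebra_simps)
      also have "\<dots> \<le> p * ((\<beta> + 1) powr q * ?Q t)"
        using p powr_above_tangent[OF q \<beta> A(1)[OF t], of "g t"] bd[OF t]
        by (intro mult_left_mono) auto
      finally show ?thesis by (simp add: mult.assoc)
    qed (simp add: h_def avg_def)
  qed
  moreover have "q * (\<beta> + 1) * avg g 1 powr p \<le> q * (\<beta> + 1) * integral {0..1} h"
    using main q \<beta> by (intro mult_left_mono) auto
  ultimately have *: "D * integral {0..1} ?P + q * (\<beta> + 1) * avg g 1 powr p
      \<le> p * (\<beta> + 1) powr q * integral {0..1} ?Q" by linarith
  have "0 \<le> integral {0..1} ?P" using P(2) by (intro integral_nonneg) auto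
  have "0 \<le> integral {0..1} ?Q" using Q(2) by (intro integral_nonneg) auto
  have "ennreal D * int_avg_pow p g + ennreal (q * (\<beta> + 1) * avg g 1 powr p)
      = ennreal (D * integral {0..1} ?P + q * (\<beta> + 1) * avg g 1 powr p)"
    using \<open>0 \<le> D\<close> q \<beta> \<open>0 \<le> integral {0..1} ?P\<close> P(1)
    by (simp add: int_avg_pow_def ennreal_mult' ennreal_plus)
  also have "\<dots> \<le> ennreal (p * (\<beta> + 1) powr q * integral {0..1} ?Q)" by (rule ennreal_leI[OF *])
  also have "\<dots> = ennreal (p * (\<beta> + 1) powr q) * int_avg_mixed p q g"
    using p by (simp add: Q(1) ennreal_mult')
  finally show ?thesis by (simp add: D_def)
qed

section \<open>Passage to unbounded functions by truncation\<close>

lemma noninc_with_integralD: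
  assumes "noninc_with_integral f g"
  shows "\<And>u. 0 < u \<Longrightarrow> u \<le> 1 \<Longrightarrow> 0 \<le> g u" "antimono_on {0<..1} g" "0 \<le> f"
    "set_integrable lborel {0<..1} g" "avg g 1 = f"
proof -
  show pos: "\<And>u. 0 < u \<Longrightarrow> u \<le> 1 \<Longrightarrow> 0 \<le> g u" and anti: "antimono_on {0<..1} g" and f: "0 \<le> f"
    using assms by (auto simp: noninc_with_integral_def)
  have "ennreal (indicator {0<..1} u *\<^sub>R g u) = ennreal (g u) * indicator {0<..1} u" for u
    by (simp add: indicator_def)
  then have nn: "(\<integral>\<^sup>+u. ennreal (indicator {0<..1} u *\<^sub>R g u) \<partial>lborel) = ennreal f"
    using assms unfolding noninc_with_integral_def by presburger
  show gi: "set_integrable lborel {0<..1} g"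
    unfolding set_integrable_def
  proof (rule integrableI_nonneg)
    show "(\<lambda>u. indicator {0<..1} u *\<^sub>R g u) \<in> borel_measurable lborel"
      using antimono_on_set_borel_measurable[OF anti] by (simp add: set_borel_measurable_def)
    show "AE u in lborel. 0 \<le> indicator {0<..1} u *\<^sub>R g u"
      by (intro AE_I2) (simp add: indicator_def pos)
  qed (simp only: nn, simp)
  have "ennreal (LINT u:{0<..1}|lborel. g u) = ennreal f"
    unfolding set_lebesgue_integral_def
    by (rule trans[OF nn_integral_eq_integral[OF gi[unfolded set_integrable_def], symmetric] nn])
       (intro AE_I2, simp add: indicator_def pos)
  moreover have "0 \<le> (LINT u:{0<..1}|lborel. g u)"
    unfolding set_lebesgue_integral_def
    by (rule Bochner_Integration.integral_nonneg) (simp add: indicator_def pos)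
  ultimately show "avg g 1 = f" using f by (simp add: avg_def)
qed

text \<open>Dominated convergence with g itself as majorant; at each point the truncation is
  eventually inactive.\<close>

lemma avg_min_tendsto:
  assumes gi: "set_integrable lborel {0<..1} g" and pos: "\<And>u. 0 < u \<Longrightarrow> u \<le> 1 \<Longrightarrow> 0 \<le> g u"
    and t: "0 < t" "t \<le> 1"
  shows "(\<lambda>n. avg (\<lambda>u. min (g u) (real n)) t) \<longlonglongrightarrow> avg g t"
proof -
  have gt: "integrable lborel (\<lambda>u. indicator {0<..t} u *\<^sub>R g u)"
    unfolding set_integrable_def[symmetric] by (rule set_integrable_subset[OF gi]) (use t in auto)
  have meas: "(\<lambda>u. indicator {0<..t} u * g u) \<in> borel_measurable borel"
    using borel_measurable_integrable[OF gt] by simp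
  have "(\<lambda>n. LINT u:{0<..t}|lborel. min (g u) (real n)) \<longlonglongrightarrow> (LINT u:{0<..t}|lborel. g u)"
    unfolding set_lebesgue_integral_def
  proof (rule integral_dominated_convergence[where w = "\<lambda>u. indicator {0<..t} u *\<^sub>R g u"])
    fix n
    have "(\<lambda>u. min (indicator {0<..t} u * g u) (indicator {0<..t} u * real n)) \<in> borel_measurable borel"
      using meas by (intro borel_measurable_min) simp_all
    also have "(\<lambda>u. min (indicator {0<..t} u * g u) (indicator {0<..t} u * real n))
        = (\<lambda>u. indicator {0<..t} u *\<^sub>R min (g u) (real n))"
      by (auto simp: indicator_def)
    finally show "(\<lambda>u. indicator {0<..t} u *\<^sub>R min (g u) (real n)) \<in> borel_measurable lborel"
      by simp
    show "AE u in lborel. norm (indicator {0<..t} u *\<^sub>R min (g u) (real n)) \<le> indicator {0<..t} u *\<^sub>R g u"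
      using pos t by (intro AE_I2) (auto simp: indicator_def)
  next
    show "AE u in lborel. (\<lambda>n. indicator {0<..t} u *\<^sub>R min (g u) (real n))
        \<longlonglongrightarrow> indicator {0<..t} u *\<^sub>R g u"
    proof (rule AE_I2)
      fix u
      have "\<forall>\<^sub>F n in sequentially. min (g u) (real n) = g u"
        using eventually_ge_at_top[of "nat \<lceil>g u\<rceil>"]
      proof eventually_elim
        case (elim n)
        then have "g u \<le> real n" by linarith
        then show ?case by simp
      qed
      then show "(\<lambda>n. indicator {0<..t} u *\<^sub>R min (g u) (real n)) \<longlonglongrightarrow> indicator {0<..t} u *\<^sub>R g u"
        by (intro tendsto_scaleR tendsto_const tendsto_eventually)
    qed
  qed (use gt borel_measurable_integrable[OF gt] in auto)
  then show ?thesis unfolding avg_def by (intro tendsto_intros)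
qed

lemma avg_inequality_ennreal:
  fixes g :: "real \<Rightarrow> real"
  assumes p: "1 < p" and q: "1 \<le> q" "q \<le> p" and \<beta>: "0 < \<beta>" and g: "noninc_with_integral f g"
  shows "ennreal ((p - 1) * q * \<beta> + (p - q)) * int_avg_pow p g + ennreal (q * (\<beta> + 1) * f powr p)
    \<le> ennreal (p * (\<beta> + 1) powr q) * int_avg_mixed p q g"
proof -
  note pos = noninc_with_integralD(1)[OF g] and anti = noninc_with_integralD(2)[OF g]
    and gi = noninc_with_integralD(4)[OF g]
  define G where "G n u = min (g u) (real n)" for n u
  have G_anti: "antimono_on {0<..1} (G n)" for n
  proof (rule monotone_onI)
    fix x y :: real
    assume "x \<in> {0<..1}" "y \<in> {0<..1}" "x \<le> y"
    then have "g y \<le> g x" by (rule monotone_onD[OF anti])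
    then show "G n x \<ge> G n y" unfolding G_def by (rule min.mono) simp
  qed
  have G_bd: "0 \<le> G n u" "G n u \<le> real n" "G n u \<le> g u" if "0 < u" "u \<le> 1" for n u
    using pos[OF that] by (auto simp: G_def)
  have G_int: "set_integrable lborel {0<..1} (G n)" for n
  proof (rule set_integrable_bounded)
    show "set_borel_measurable borel {0<..1} (G n)"
      by (rule antimono_on_set_borel_measurable[OF G_anti]) simp
    show "\<bar>G n t\<bar> \<le> real n" if "0 < t" "t \<le> 1" for t using G_bd[OF that, of n] by simp
  qed
  have A0: "0 \<le> avg (G n) t" if "0 < t" "t \<le> 1" for n t
    by (rule avg_bounds[OF G_int that], rule G_bd) (use that in auto)
  have A_mono: "avg (G m) t \<le> avg (G n) t" if "m \<le> n" "0 < t" "t \<le> 1" for m n t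
    by (rule avg_mono[OF G_int G_int that(2,3)]) (use \<open>m \<le> n\<close> in \<open>simp add: G_def min.coboundedI2 min.mono\<close>)
  have A_le: "avg (G n) t \<le> avg g t" if "0 < t" "t \<le> 1" for n t
    by (rule avg_mono[OF G_int gi that]) (simp add: G_def)
  have A_lim: "(\<lambda>n. avg (G n) t powr p) \<longlonglongrightarrow> avg g t powr p" if "0 < t" "t \<le> 1" for t
  proof (rule tendsto_powr')
    show "(\<lambda>n. avg (G n) t) \<longlonglongrightarrow> avg g t"
      unfolding G_def by (rule avg_min_tendsto[OF gi pos that])
    show "avg g t \<noteq> 0 \<or> 0 < p \<and> (\<forall>\<^sub>F n in sequentially. 0 \<le> avg (G n) t)"
      using A0[OF that] p by simp
  qed (rule tendsto_const)
  \<comment> \<open>Both exponents p - q and q are nonnegative, so the integrand grows with A and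
    with g. This comparison replaces a limit on the right-hand side.\<close>
  have mixed_le: "int_avg_mixed p q (G n) \<le> int_avg_mixed p q g" for n
    unfolding int_avg_mixed_def
  proof (intro nn_integral_mono)
    fix t
    show "ennreal (avg (G n) t powr (p - q) * G n t powr q) * indicator {0<..1} t
        \<le> ennreal (avg g t powr (p - q) * g t powr q) * indicator {0<..1} t"
    proof (cases "0 < t \<and> t \<le> 1")
      case True
      then have "avg (G n) t powr (p - q) * G n t powr q \<le> avg g t powr (p - q) * g t powr q"
        using q A0[of t n] A_le[of t n] G_bd[of t n] by (intro mult_mono powr_mono2) auto
      then show ?thesis using True by (simp add: ennreal_leI)
    qed auto
  qed
  have I_lim: "(\<lambda>n. int_avg_pow p (G n)) \<longlonglongrightarrow> int_avg_pow p g"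
    unfolding int_avg_pow_def
  proof (rule nn_integral_LIMSEQ)
    show "incseq (\<lambda>n t. ennreal (avg (G n) t powr p) * indicator {0<..1} t)"
    proof (intro incseq_SucI le_funI)
      fix n t
      show "ennreal (avg (G n) t powr p) * indicator {0<..1} t
          \<le> ennreal (avg (G (Suc n)) t powr p) * indicator {0<..1} t"
        using A0[of t n] A_mono[of n "Suc n" t] p
        by (auto simp: indicator_def intro!: ennreal_leI powr_mono2)
    qed
    show "(\<lambda>t. ennreal (avg (G n) t powr p) * indicator {0<..1} t) \<in> borel_measurable lborel" for n
    proof -
      have [measurable]: "(\<lambda>t. indicator {0<..1} t * avg (G n) t) \<in> borel_measurable borel"
        using set_borel_measurable_avg[OF G_int, of n] by (simp add: set_borel_measurable_def)
      have "(\<lambda>t. ennreal ((indicator {0<..1} t * avg (G n) t) powr p) * indicator {0<..1} t)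
          \<in> borel_measurable borel"
        by measurable
      also have "(\<lambda>t. ennreal ((indicator {0<..1} t * avg (G n) t) powr p) * indicator {0<..1} t)
          = (\<lambda>t. ennreal (avg (G n) t powr p) * indicator {0<..1} t)"
        by (auto simp: indicator_def)
      finally show ?thesis by simp
    qed
    show "(\<lambda>n. ennreal (avg (G n) t powr p) * indicator {0<..1} t)
        \<longlonglongrightarrow> ennreal (avg g t powr p) * indicator {0<..1} t" for t
      using A_lim[of t] by (cases "0 < t \<and> t \<le> 1") (auto intro: tendsto_ennrealI)
  qed
  have f_lim: "(\<lambda>n. ennreal (q * (\<beta> + 1) * avg (G n) 1 powr p))
      \<longlonglongrightarrow> ennreal (q * (\<beta> + 1) * avg g 1 powr p)"
    by (intro tendsto_ennrealI tendsto_mult_left A_lim) simp_all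
  have "(\<lambda>n. ennreal ((p - 1) * q * \<beta> + (p - q)) * int_avg_pow p (G n)
        + ennreal (q * (\<beta> + 1) * avg (G n) 1 powr p))
      \<longlonglongrightarrow> ennreal ((p - 1) * q * \<beta> + (p - q)) * int_avg_pow p g
        + ennreal (q * (\<beta> + 1) * avg g 1 powr p)"
    by (rule tendsto_add[OF ennreal_tendsto_cmult[OF _ I_lim] f_lim]) simp
  then have "ennreal ((p - 1) * q * \<beta> + (p - q)) * int_avg_pow p g
        + ennreal (q * (\<beta> + 1) * avg g 1 powr p)
      \<le> ennreal (p * (\<beta> + 1) powr q) * int_avg_mixed p q g"
  proof (rule LIMSEQ_le_const2, intro exI allI impI)
    fix n
    show "ennreal ((p - 1) * q * \<beta> + (p - q)) * int_avg_pow p (G n)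
        + ennreal (q * (\<beta> + 1) * avg (G n) 1 powr p)
      \<le> ennreal (p * (\<beta> + 1) powr q) * int_avg_mixed p q g"
      by (rule order_trans[OF avg_inequality_bounded[OF p q \<beta> G_anti, of n "real n"]
            mult_left_mono[OF mixed_le]])
         (simp_all add: G_bd)
  qed
  then show ?thesis using noninc_with_integralD(5)[OF g] by simp
qed

text \<open>Division by \<open>D\<close> > 0 restores the subtracted form. If the mixed integral is
  infinite, so is the right-hand side; otherwise the cleared inequality forces the integral of A^p
  to be finite too, and real arithmetic suffices.\<close>

lemma avg_inequality_ereal:
  fixes g :: "real \<Rightarrow> real"
  assumes p: "1 < p" and q: "1 \<le> q" "q \<le> p" and \<beta>: "0 < \<beta>" and g: "noninc_with_integral f g"
  shows "enn2ereal (int_avg_pow p g)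
     \<le> ereal (- (q * (\<beta> + 1) / ((p - 1) * q * \<beta> + (p - q))) * f powr p)
       + ereal (p * (\<beta> + 1) powr q / ((p - 1) * q * \<beta> + (p - q))) * enn2ereal (int_avg_mixed p q g)"
proof -
  define D where "D = (p - 1) * q * \<beta> + (p - q)"
  have D: "0 < D" using p q \<beta> by (auto simp: D_def intro: add_pos_nonneg)
  define K where "K = p * (\<beta> + 1) powr q"
  have K: "0 < K" using p \<beta> by (simp add: K_def)
  define B where "B = q * (\<beta> + 1) * f powr p"
  have B: "0 \<le> B" using q \<beta> by (simp add: B_def)
  have le: "ennreal D * int_avg_pow p g + ennreal B \<le> ennreal K * int_avg_mixed p q g"
    using avg_inequality_ennreal[OF p q \<beta> g] by (simp add: D_def K_def B_def)
  have "enn2ereal (int_avg_pow p g) \<le> ereal (- (B / D)) + ereal (K / D) * enn2ereal (int_avg_mixed p q g)"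
  proof (cases "int_avg_mixed p q g")
    case top
    then show ?thesis using K D by simp
  next
    case (real j)
    then have le': "ennreal D * int_avg_pow p g + ennreal B \<le> ennreal (K * j)"
      using le K by (simp add: ennreal_mult')
    then have "int_avg_pow p g \<noteq> top"
      using D by (auto simp: ennreal_mult_top top_unique)
    then obtain i where i: "0 \<le> i" "int_avg_pow p g = ennreal i"
      by (cases "int_avg_pow p g") auto
    have "ennreal (D * i + B) \<le> ennreal (K * j)"
      using le' i D B by (simp add: ennreal_mult' ennreal_plus)
    then have "D * i + B \<le> K * j" using K real by (subst (asm) ennreal_le_iff) auto
    then have "i \<le> - (B / D) + K / D * j" using D by (simp add: field_simps)
    then show ?thesis using i real by (simp add: enn2ereal_ennreal)
  qed
  then show ?thesis by (simp add: D_def K_def B_def)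
qed

section \<open>Power functions and sharpness\<close>

lemma nn_integral_powr:
  fixes k a t :: real
  assumes "0 \<le> k" "a < 1" "0 < t"
  shows "(\<integral>\<^sup>+u\<in>{0<..t}. ennreal (k * u powr (- a)) \<partial>lborel) = ennreal (k * (t powr (1 - a) / (1 - a)))"
proof (rule nn_integral_has_integral_lebesgue')
  have "((\<lambda>u. u powr (- a)) has_integral t powr (- a + 1) / (- a + 1)) {0..t}"
    by (rule has_integral_powr_from_0) (use assms in auto)
  then have "((\<lambda>u. u powr (- a)) has_integral t powr (1 - a) / (1 - a)) {0<..t}"
    by (simp add: has_integral_Ioc_iff_Icc)
  then show "((\<lambda>u. k * u powr (- a)) has_integral k * (t powr (1 - a) / (1 - a))) {0<..t}"
    by (rule has_integral_mult_right)
qed (use assms in simp)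

text \<open>Averaging multiplies u^(-a) by 1/(1-a). The factor f(1-a) normalises the integral over
  (0,1] to f.\<close>

lemma avg_powr:
  fixes f a t :: real
  assumes "0 \<le> f" "a < 1" "0 < t"
  shows "avg (\<lambda>u. f * (1 - a) * u powr (- a)) t = f * t powr (- a)"
proof -
  let ?g = "\<lambda>u. f * (1 - a) * u powr (- a)"
  have "(LINT u:{0<..t}|lborel. ?g u) = enn2real (\<integral>\<^sup>+u. ennreal (indicator {0<..t} u *\<^sub>R ?g u) \<partial>lborel)"
    unfolding set_lebesgue_integral_def
  proof (rule integral_eq_nn_integral)
    show "(\<lambda>u. indicator {0<..t} u *\<^sub>R ?g u) \<in> borel_measurable lborel" by measurable
    show "AE u in lborel. 0 \<le> indicator {0<..t} u *\<^sub>R ?g u"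
      using assms by (intro AE_I2) (simp add: indicator_def)
  qed
  also have "(\<integral>\<^sup>+u. ennreal (indicator {0<..t} u *\<^sub>R ?g u) \<partial>lborel)
      = (\<integral>\<^sup>+u\<in>{0<..t}. ennreal (?g u) \<partial>lborel)"
    by (intro nn_integral_cong) (simp add: indicator_def)
  also have "\<dots> = ennreal (f * (1 - a) * (t powr (1 - a) / (1 - a)))"
    by (rule nn_integral_powr) (use assms in auto)
  also have "f * (1 - a) * (t powr (1 - a) / (1 - a)) = f * t powr (1 - a)"
    using assms by simp
  also have "enn2real (ennreal (f * t powr (1 - a))) = f * t powr (1 - a)"
    using assms by (intro enn2real_ennreal) simp
  finally have "(LINT u:{0<..t}|lborel. ?g u) = f * t powr (1 - a)" .
  then show ?thesis
    using assms unfolding avg_def by (simp only:) (simp add: powr_diff powr_minus divide_inverse)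
qed

lemma noninc_powr:
  fixes f a :: real
  assumes "0 \<le> f" "0 \<le> a" "a < 1"
  shows "noninc_with_integral f (\<lambda>u. f * (1 - a) * u powr (- a))"
proof -
  have "antimono_on {0<..1} (\<lambda>u. f * (1 - a) * u powr (- a))"
  proof (rule monotone_onI)
    fix x y :: real
    assume xy: "x \<in> {0<..1}" "x \<le> y"
    have "y powr (- a) \<le> x powr (- a)"
      by (rule powr_mono2') (use xy assms in auto)
    then show "f * (1 - a) * x powr (- a) \<ge> f * (1 - a) * y powr (- a)"
      using assms by (intro mult_left_mono) auto
  qed
  then show ?thesis
    unfolding noninc_with_integral_def
    using nn_integral_powr[of "f * (1 - a)" a 1] assms by simp
qed

text \<open>Both integrands are constant multiples of t^(-ap), which is integrable at 0 because ap <
  1; the two integrals differ by the factor (1-a)^q.\<close>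

lemma int_avg_powr:
  fixes f a p q :: real
  assumes "0 \<le> f" "a < 1" "a * p < 1"
  defines "g \<equiv> \<lambda>u. f * (1 - a) * u powr (- a)"
  shows "int_avg_pow p g = ennreal (f powr p / (1 - a * p))"
    and "int_avg_mixed p q g = ennreal ((1 - a) powr q * f powr p / (1 - a * p))"
proof -
  have "int_avg_pow p g = (\<integral>\<^sup>+t\<in>{0<..1}. ennreal (f powr p * t powr (- (a * p))) \<partial>lborel)"
    unfolding int_avg_pow_def
  proof (rule set_nn_integral_cong)
    fix t :: real
    assume "t \<in> space lborel \<inter> {0<..1}"
    then show "ennreal (avg g t powr p) = ennreal (f powr p * t powr (- (a * p)))"
      unfolding g_def using assms(1,2) by (simp add: avg_powr powr_mult powr_powr)
  qed auto
  also have "\<dots> = ennreal (f powr p * (1 powr (1 - a * p) / (1 - a * p)))"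
    by (rule nn_integral_powr) (use assms in auto)
  finally show "int_avg_pow p g = ennreal (f powr p / (1 - a * p))" by simp
  have "int_avg_mixed p q g
      = (\<integral>\<^sup>+t\<in>{0<..1}. ennreal ((1 - a) powr q * f powr p * t powr (- (a * p))) \<partial>lborel)"
    unfolding int_avg_mixed_def
  proof (rule set_nn_integral_cong)
    fix t :: real
    assume "t \<in> space lborel \<inter> {0<..1}"
    then have t: "0 < t" by simp
    have "avg g t powr (p - q) * g t powr q
        = (1 - a) powr q * (f powr (p - q) * f powr q) * (t powr (- a * (p - q)) * t powr (- a * q))"
      unfolding g_def using assms(1,2) t by (simp add: avg_powr powr_mult powr_powr)
    also have "\<dots> = (1 - a) powr q * f powr p * t powr (- (a * p))"
      by (simp add: algebra_simps flip: powr_add)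
    finally show "ennreal (avg g t powr (p - q) * g t powr q)
        = ennreal ((1 - a) powr q * f powr p * t powr (- (a * p)))" by simp
  qed auto
  also have "\<dots> = ennreal ((1 - a) powr q * f powr p * (1 powr (1 - a * p) / (1 - a * p)))"
    by (rule nn_integral_powr) (use assms in auto)
  finally show "int_avg_mixed p q g = ennreal ((1 - a) powr q * f powr p / (1 - a * p))" by simp
qed

text \<open>The last conclusion is the failure of the inequality with constant c for the multiple of
  u^(-a) with integral f, after dividing by f^p and multiplying by 1 - ap > 0.\<close>

lemma exists_near_extremal_exponent:
  fixes p q \<beta> c :: real
  assumes p: "1 < p" and q: "1 \<le> q" "q \<le> p" and \<beta>: "0 < \<beta>" "\<beta> \<le> 1 / (p - 1)"
    and c: "q * (\<beta> + 1) / ((p - 1) * q * \<beta> + (p - q)) < c"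
  obtains a where "0 < a" "a * p < 1"
    "p * (\<beta> + 1) powr q / ((p - 1) * q * \<beta> + (p - q)) * (1 - a) powr q < 1 + c * (1 - a * p)"
proof -
  define D where "D = (p - 1) * q * \<beta> + (p - q)"
  have D: "0 < D" using p q \<beta> by (auto simp: D_def intro: add_pos_nonneg)
  define a0 where "a0 = \<beta> / (\<beta> + 1)"
  have a0: "0 < a0" "a0 < 1" "1 - a0 = 1 / (\<beta> + 1)" using \<beta> by (simp_all add: a0_def field_simps)
  have \<beta>p: "\<beta> * (p - 1) \<le> 1" using p \<beta> by (simp add: field_simps)
  have a0p: "1 - a0 * p = (1 - \<beta> * (p - 1)) / (\<beta> + 1)"
    using \<beta> by (simp add: a0_def field_simps)
  then have a0p_nonneg: "0 \<le> 1 - a0 * p" using \<beta>p \<beta> by simp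
  define K where "K = p * (\<beta> + 1) powr q / D"
  define \<phi> where "\<phi> a = c * (1 - a * p) + 1 - K * (1 - a) powr q" for a
  have "(\<beta> + 1) powr q * (1 - a0) powr q = 1"
    using \<beta> by (simp add: a0(3) powr_divide)
  then have K: "K * (1 - a0) powr q = p / D" by (simp add: K_def mult.assoc)
  \<comment> \<open>Writing c0 = q(\<beta>+1)/D for the critical constant, this says \<phi>(a0) = (c
    - c0)(1 - a0 p). It is nonnegative because \<beta> \<le> 1/(p-1) means a0 p \<le> 1, and it is 0
    at the endpoint \<beta> = 1/(p-1).\<close>
  have "p / D - 1 = q * (\<beta> + 1) / D * (1 - a0 * p)"
  proof -
    have "q * (\<beta> + 1) / D * (1 - a0 * p) = q * (1 - \<beta> * (p - 1)) / D" using \<beta> by (simp add: a0p)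
    also have "q * (1 - \<beta> * (p - 1)) = p - D" by (simp add: D_def algebra_simps)
    finally show ?thesis using D by (simp add: diff_divide_distrib)
  qed
  also have "\<dots> \<le> c * (1 - a0 * p)"
    using c a0p_nonneg by (intro mult_right_mono) (simp_all add: D_def)
  finally have "0 \<le> \<phi> a0" using K by (simp add: \<phi>_def)
  have d: "((\<lambda>a. (1 - a) powr q) has_real_derivative q * (1 - a0) powr (q - 1) * (- 1)) (at a0)"
  proof -
    have "((\<lambda>a. 1 - a) has_real_derivative - 1) (at a0)"
      by (auto intro!: derivative_eq_intros)
    from DERIV_fun_powr[OF this, of q] a0(2) show ?thesis by simp
  qed
  have "((\<lambda>a. c * (1 - a * p) + 1) has_real_derivative c * (- p)) (at a0)"
    by (auto intro!: derivative_eq_intros)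
  from DERIV_diff[OF this DERIV_cmult[OF d, of K]]
  have "(\<phi> has_real_derivative c * (- p) - K * (q * (1 - a0) powr (q - 1) * (- 1))) (at a0)"
    unfolding \<phi>_def .
  \<comment> \<open>From 1/(1 - a0) = \<beta> + 1 and K(1 - a0)^q = p/D, the derivative of \<phi> at
    a0 becomes p(c0 - c), with c0 = q(\<beta>+1)/D. So it is negative for every c above c0.\<close>
  moreover have "(1 - a0) powr (q - 1) = (1 - a0) powr q * (\<beta> + 1)"
    using \<beta> by (simp add: a0(3) powr_diff)
  then have "c * (- p) - K * (q * (1 - a0) powr (q - 1) * (- 1)) = - (c * p) + q * (\<beta> + 1) * (K * (1 - a0) powr q)"
    by (simp add: algebra_simps)
  moreover have "- (c * p) + q * (\<beta> + 1) * (K * (1 - a0) powr q) = p * (q * (\<beta> + 1) / D - c)"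
    unfolding K by (simp add: algebra_simps add_divide_distrib)
  moreover have "p * (q * (\<beta> + 1) / D - c) < 0" using c p by (simp add: D_def mult_pos_neg)
  ultimately obtain d where d: "0 < d" "\<And>h. 0 < h \<Longrightarrow> h < d \<Longrightarrow> \<phi> a0 < \<phi> (a0 - h)"
    using DERIV_neg_dec_left by metis
  \<comment> \<open>The first bound keeps a0 - h where \<phi> exceeds \<phi>(a0), the second keeps
    it positive. A strict step below a0 also gives (a0 - h) p < 1 when a0 p = 1.\<close>
  define h where "h = min (d / 2) (a0 / 2)"
  have h: "0 < h" "h < d" "h < a0" using d a0 by (auto simp: h_def)
  have "0 < \<phi> (a0 - h)" using d(2)[OF h(1,2)] \<open>0 \<le> \<phi> a0\<close> by simp
  moreover have "0 < h * p" using h p by simp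
  then have "(a0 - h) * p < 1" using a0p_nonneg by (simp add: left_diff_distrib)
  ultimately show ?thesis using that[of "a0 - h"] h by (simp add: \<phi>_def K_def D_def)
qed

text \<open>For the exponent found above both integrals are finite, so the comparison takes place in
  the reals. Dividing the exponent inequality by 1 - ap and multiplying by f^p gives the strict
  reverse of the inequality with constant c.\<close>

lemma avg_inequality_sharp:
  fixes p q \<beta> c f :: real
  assumes p: "1 < p" and q: "1 \<le> q" "q \<le> p" and \<beta>: "0 < \<beta>" "\<beta> \<le> 1 / (p - 1)" and f: "0 < f"
    and c: "q * (\<beta> + 1) / ((p - 1) * q * \<beta> + (p - q)) < c"
  shows "\<exists>g. noninc_with_integral f g \<and>
     \<not> (enn2ereal (int_avg_pow p g) \<le> ereal (- c * f powr p)
        + ereal (p * (\<beta> + 1) powr q / ((p - 1) * q * \<beta> + (p - q))) * enn2ereal (int_avg_mixed p q g))"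
proof -
  define K where "K = p * (\<beta> + 1) powr q / ((p - 1) * q * \<beta> + (p - q))"
  obtain a where a: "0 < a" "a * p < 1" and lt: "K * (1 - a) powr q < 1 + c * (1 - a * p)"
    using exists_near_extremal_exponent[OF p q \<beta> c] unfolding K_def by metis
  have "a * 1 < a * p" using a p by (intro mult_strict_left_mono) auto
  then have "a < 1" using a by linarith
  define g where "g = (\<lambda>u. f * (1 - a) * u powr (- a))"
  have "K * (1 - a) powr q / (1 - a * p) < (1 + c * (1 - a * p)) / (1 - a * p)"
    using lt a by (intro divide_strict_right_mono) auto
  also have "\<dots> = 1 / (1 - a * p) + c" using a by (simp add: add_divide_distrib)
  finally have "f powr p * (K * (1 - a) powr q / (1 - a * p)) < f powr p * (1 / (1 - a * p) + c)"
    using f by (intro mult_strict_left_mono) auto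
  then have "- c * f powr p + K * ((1 - a) powr q * f powr p / (1 - a * p)) < f powr p / (1 - a * p)"
    by (simp add: algebra_simps)
  moreover have "enn2ereal (int_avg_pow p g) = ereal (f powr p / (1 - a * p))"
    "enn2ereal (int_avg_mixed p q g) = ereal ((1 - a) powr q * f powr p / (1 - a * p))"
    unfolding g_def using int_avg_powr[of f a p] f a \<open>a < 1\<close> by (simp_all add: enn2ereal_ennreal)
  ultimately have "\<not> (enn2ereal (int_avg_pow p g)
      \<le> ereal (- c * f powr p) + ereal K * enn2ereal (int_avg_mixed p q g))"
    by simp
  moreover have "noninc_with_integral f g"
    unfolding g_def using f a \<open>a < 1\<close> by (intro noninc_powr) auto
  ultimately show ?thesis unfolding K_def by blast
qed

theorem corollary1:
  fixes p q :: real
  assumes "1 < p" and "1 \<le> q" and "q \<le> p"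
  shows "(\<forall>\<beta> f g. 0 < \<beta> \<longrightarrow> noninc_with_integral f g \<longrightarrow>
            enn2ereal (int_avg_pow p g)
              \<le> ereal (- (q * (\<beta> + 1) / ((p - 1) * q * \<beta> + (p - q))) * f powr p)
                + ereal (p * (\<beta> + 1) powr q / ((p - 1) * q * \<beta> + (p - q)))
                  * enn2ereal (int_avg_mixed p q g))
       \<and> (\<forall>\<beta> f c. 0 < \<beta> \<longrightarrow> \<beta> \<le> 1 / (p - 1) \<longrightarrow> 0 < f \<longrightarrow>
            q * (\<beta> + 1) / ((p - 1) * q * \<beta> + (p - q)) < c \<longrightarrow>
            (\<exists>g. noninc_with_integral f g \<and>
              \<not> (enn2ereal (int_avg_pow p g)
                  \<le> ereal (- c * f powr p)
                    + ereal (p * (\<beta> + 1) powr q / ((p - 1) * q * \<beta> + (p - q)))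
                      * enn2ereal (int_avg_mixed p q g))))"
  using avg_inequality_ereal[OF assms] avg_inequality_sharp[OF assms] by blast

end
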